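(* Let $C=(x_1,\dots,x_r)$ be a collection of positions, let $B$ be its spectrum kernel, and let $a$ be a positive integer. Then the collection of positions $aC=(ax_1,\dots,ax_r)$ has spectrum kernel $\{b\,\eta(a,b)\mid b\in B\}$.
   Context: A collection of positions is a finite sequence $(x_1,\dots,x_r)$, $r\ge1$, of integers with $0\le x_1<\dots<x_r$. A solution to the recursion defined by $(x_1,\dots,x_r)$ is an infinite $(0,1)$-sequence $T=(T(0),T(1),\dots)$ such that, with $\delta=x_r-x_1$, $T(i)=\sum_{l=2}^{r}T(i-(x_l-x_1)) \pmod 2$ for all $i\ge\delta$ (the first $\delta$ symbols are arbitrary; an empty sum is $0$). Every solution is eventually periodic; a period of $T$ is a non-empty finite word $\pi$ such that $T=\rho\,\pi\pi\pi\cdots$ for some finite (possibly empty) word $\rho$. The spectrum $S$ of a collection is the set of all lengths of periods of non-zero solutions to its recursion. The spectrum kernel is $K(S)=\{y\in S\mid \forall x\in S\,[x\ne y\Rightarrow x\nmid y]\}$. For positive integers $n,m$, $\eta(n,m)$ denotes the maximal divisor of $n$ all of whose prime divisors divide $m$ (for instance $\eta(150,20)=50$; $\eta(n,m)=1$ if $\gcd(n,m)=1$). *)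

theory Defs
  imports Main "HOL-Library.Z2" "HOL-Computational_Algebra.Primes"
begin

definition position_collection :: "nat list \<Rightarrow> bool" where
  "position_collection xs \<longleftrightarrow> xs \<noteq> [] \<and> sorted_wrt (<) xs"

text \<open>The list is indexed from 0, so the entry \<open>xs ! l\<close> is $x_{l+1}$. Sequences take values in
  the two-element field \<^typ>\<open>bit\<close>, whose addition is addition modulo 2. For a strictly increasing
  list, none of the subtractions truncates.\<close>

definition is_solution :: "nat list \<Rightarrow> (nat \<Rightarrow> bit) \<Rightarrow> bool" where
  "is_solution xs T \<longleftrightarrow>
     (\<forall>i \<ge> last xs - hd xs. T i = (\<Sum>l = 1..<length xs. T (i - (xs ! l - xs ! 0))))"

text \<open>The word \<open>u\<close> is the pre-period \<open>\<rho>\<close>, so that $T = u\,w\,w\,w\cdots$.\<close>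

definition is_period :: "(nat \<Rightarrow> bit) \<Rightarrow> bit list \<Rightarrow> bool" where
  "is_period T w \<longleftrightarrow> w \<noteq> [] \<and>
     (\<exists>u. \<forall>i. T i = (if i < length u then u ! i else w ! ((i - length u) mod length w)))"

definition spectrum :: "nat list \<Rightarrow> nat set" where
  "spectrum xs = {length w | w T. is_solution xs T \<and> T \<noteq> (\<lambda>_. 0) \<and> is_period T w}"

definition spectrum_kernel :: "nat list \<Rightarrow> nat set" where
  "spectrum_kernel xs =
     {y \<in> spectrum xs. \<forall>x \<in> spectrum xs. x \<noteq> y \<longrightarrow> \<not> x dvd y}"

text \<open>Meaningful for \<open>n > 0\<close>, where the set is finite and contains 1.\<close>

definition eta :: "nat \<Rightarrow> nat \<Rightarrow> nat" where
  "eta n m = Max {d. d dvd n \<and> (\<forall>p. prime p \<and> p dvd d \<longrightarrow> p dvd m)}"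

end

theory Submission imports Defs "HOL-Number_Theory.Cong" begin

text \<open>The recursion is reversible, so its periodic solutions extend to two-sided sequences
  annihilated by the shift polynomial of \<open>C\<close>. If \<open>T\<close> is such a sequence of period \<open>b\<close> for \<open>C\<close>, write
  \<open>a = e c\<close> with \<open>e = \<eta>(a,b)\<close> and \<open>c\<close> coprime to \<open>b\<close>; reindexing \<open>T\<close> by an inverse of \<open>c\<close> modulo \<open>b\<close>
  and then inserting zeros gives a solution for \<open>aC\<close> of period \<open>b e\<close>. Conversely, decimating by \<open>a\<close> a
  solution for \<open>aC\<close> of period \<open>n\<close> gives one for \<open>C\<close> of period \<open>b = n / gcd(n,a)\<close>, and \<open>b \<eta>(a,b)\<close>
  divides \<open>n\<close>. As \<open>b \<eta>(a,b) dvd b' \<eta>(a,b')\<close> holds exactly when \<open>b dvd b'\<close>, minimal elements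
  correspond.\<close>

section \<open>Divisibility properties of \<open>eta\<close>\<close>

lemma
  assumes "a > 0"
  shows eta_dvd: "eta a b dvd a"
    and prime_dvd_eta: "prime p \<Longrightarrow> p dvd eta a b \<Longrightarrow> p dvd b"
    and dvd_imp_le_eta: "d dvd a \<Longrightarrow> (\<And>p. prime p \<Longrightarrow> p dvd d \<Longrightarrow> p dvd b) \<Longrightarrow> d \<le> eta a b"
proof -
  let ?D = "{d. d dvd a \<and> (\<forall>p. prime p \<and> p dvd d \<longrightarrow> p dvd b)}"
  have fin: "finite ?D"
    using assms by (auto intro: finite_subset[OF _ finite_divisors_nat])
  have "1 \<in> ?D"
    by (auto simp: prime_nat_iff)
  then have "Max ?D \<in> ?D"
    using fin Max_in by blast
  then show "eta a b dvd a" "prime p \<Longrightarrow> p dvd eta a b \<Longrightarrow> p dvd b"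
    unfolding eta_def by auto
  show "d dvd a \<Longrightarrow> (\<And>p. prime p \<Longrightarrow> p dvd d \<Longrightarrow> p dvd b) \<Longrightarrow> d \<le> eta a b"
    unfolding eta_def using fin by (intro Max_ge) auto
qed

lemma eta_pos: "a > 0 \<Longrightarrow> eta a b > 0"
  using eta_dvd dvd_pos_nat by blast

text \<open>A prime \<open>p\<close> dividing both sides would make \<open>eta a b * p\<close> a
  larger divisor of \<open>a\<close> whose primes all divide \<open>b\<close>, against
  maximality.\<close>

lemma coprime_div_eta:
  assumes "a > 0"
  shows "coprime (a div eta a b) b"
proof (rule ccontr)
  assume "\<not> coprime (a div eta a b) b"
  then obtain p where p: "prime p" "p dvd a div eta a b" "p dvd b"
    by (metis coprime_iff_gcd_eq_1 gcd_nat.bounded_iff prime_factor_nat)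
  have "eta a b * p dvd eta a b * (a div eta a b)"
    using p(2) by (rule mult_dvd_mono[OF dvd_refl])
  then have "eta a b * p dvd a"
    using eta_dvd[OF assms] by simp
  moreover have "q dvd b" if "prime q" "q dvd eta a b * p" for q
    using that p prime_dvd_eta[OF assms] by (metis prime_dvd_mult_iff primes_dvd_imp_eq)
  ultimately have "eta a b * p \<le> eta a b"
    using dvd_imp_le_eta[OF assms] by blast
  then show False
    using eta_pos[OF assms, of b] prime_gt_1_nat[OF p(1)] by simp
qed

lemma coprime_if_primes_dvd:
  fixes d b c :: nat
  assumes "\<And>p. prime p \<Longrightarrow> p dvd d \<Longrightarrow> p dvd b" and "coprime b c"
  shows "coprime d c"
proof (rule ccontr)
  assume "\<not> coprime d c"
  then obtain p where p: "prime p" "p dvd d" "p dvd c"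
    by (metis coprime_iff_gcd_eq_1 gcd_nat.bounded_iff prime_factor_nat)
  with assms show False
    by (meson coprime_common_divisor not_prime_unit)
qed

text \<open>This upgrades maximality in size to maximality under divisibility: the primes of
  \<open>d\<close> divide \<open>b\<close>, so \<open>d\<close> is coprime to the cofactor
  \<open>a div eta a b\<close> and must divide the other factor of \<open>a\<close>.\<close>

lemma dvd_etaI:
  assumes "a > 0" and "d dvd a" and "\<And>p. prime p \<Longrightarrow> p dvd d \<Longrightarrow> p dvd b"
  shows "d dvd eta a b"
proof -
  have "coprime d (a div eta a b)"
    using assms(3) coprime_div_eta[OF assms(1), of b]
    by (intro coprime_if_primes_dvd[of d b]) (auto simp: coprime_commute)
  moreover have "d dvd eta a b * (a div eta a b)"
    using assms(2) eta_dvd[OF assms(1)] by simp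
  ultimately show ?thesis
    by (simp add: coprime_dvd_mult_left_iff)
qed

lemma eta_mono_dvd: "a > 0 \<Longrightarrow> b dvd b' \<Longrightarrow> eta a b dvd eta a b'"
  by (meson dvd_etaI dvd_trans eta_dvd prime_dvd_eta)

text \<open>Every prime of \<open>b\<close> divides \<open>b'\<close>, hence \<open>eta a b\<close>
  divides \<open>eta a b'\<close>; the quotient of the two is coprime to \<open>b\<close> and
  cancels.\<close>

lemma mult_eta_dvd_cancel:
  assumes "a > 0" and dvd: "b * eta a b dvd b' * eta a b'"
  shows "b dvd b'"
proof -
  have "p dvd b'" if "prime p" "p dvd b" for p
    using that dvd prime_dvd_eta[OF assms(1)]
    by (meson dvd_mult2 dvd_trans prime_dvd_mult_iff)
  then have "eta a b dvd eta a b'"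
    using assms(1) by (meson dvd_etaI eta_dvd prime_dvd_eta)
  then obtain f where f: "eta a b' = eta a b * f"
    by blast
  \<comment> \<open>\<open>eta a b * f\<close> equals \<open>eta a b'\<close>, a divisor of
    \<open>a\<close>; this puts \<open>f\<close> into the part of \<open>a\<close> coprime to
    \<open>b\<close>.\<close>
  have "f dvd a div eta a b"
    using f eta_dvd[OF assms(1), of b'] eta_pos[OF assms(1), of b]
    by (metis dvd_mult_left dvd_mult_div_cancel nat_mult_dvd_cancel1)
  then have "coprime b f"
    using coprime_div_eta[OF assms(1), of b] coprime_divisors by (metis coprime_commute dvd_refl)
  moreover have "b dvd b' * f"
    using dvd eta_pos[OF assms(1), of b] unfolding f by (simp add: mult.left_commute mult.commute)
  ultimately show ?thesis
    by (simp add: coprime_dvd_mult_left_iff)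
qed

text \<open>\<open>b\<close> is coprime to \<open>a div gcd n a\<close>, hence so is
  \<open>eta a b\<close>; being a divisor of \<open>a\<close>, it divides \<open>gcd n a\<close>,
  and \<open>b * gcd n a = n\<close>.\<close>

lemma div_gcd_mult_eta_dvd:
  fixes n a :: nat
  assumes "a > 0"
  defines "b \<equiv> n div gcd n a"
  shows "b * eta a b dvd n"
proof -
  have "coprime b (a div gcd n a)"
    unfolding b_def using assms by (intro div_gcd_coprime) auto
  then have "coprime (eta a b) (a div gcd n a)"
    using prime_dvd_eta[OF assms(1)] by (blast intro: coprime_if_primes_dvd)
  moreover have "eta a b dvd gcd n a * (a div gcd n a)"
    using eta_dvd[OF assms(1)] by (simp only: dvd_mult_div_cancel[OF gcd_dvd2])
  ultimately have "eta a b dvd gcd n a"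
    by (simp only: coprime_dvd_mult_left_iff)
  then have "b * eta a b dvd b * gcd n a"
    by simp
  then show ?thesis
    by (simp add: b_def)
qed

section \<open>Periodic and eventually periodic sequences\<close>

lemma periodic_add_mult:
  fixes T :: "int \<Rightarrow> 'a"
  assumes "\<And>i. T (i + n) = T i"
  shows "T (i + k * n) = T i"
proof (induction k rule: int_induct[where k = 0])
  case (step1 k)
  then show ?case
    using assms[of "i + k * n"] by (simp add: algebra_simps)
next
  case (step2 k)
  then show ?case
    using assms[of "i + (k - 1) * n"] by (simp add: algebra_simps)
qed simp

lemma periodic_mod_eq:
  fixes T :: "int \<Rightarrow> 'a"
  assumes "\<And>i. T (i + n) = T i" and "i mod n = j mod n"
  shows "T i = T j"
proof -
  obtain k where "i = j + k * n"
    using assms(2) by (metis mod_eqE mult.commute)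
  then show ?thesis
    using periodic_add_mult[where T = T and n = n, OF assms(1)] by simp
qed

text \<open>Trades period words for shift invariance of a tail: any block of length \<open>n\<close>
  starting at or after the start of the tail serves as \<open>w\<close>.\<close>

lemma is_period_iff:
  "(\<exists>w. length w = n \<and> is_period T w) \<longleftrightarrow> n > 0 \<and> (\<exists>N. \<forall>i\<ge>N. T (i + n) = T i)"
proof
  assume "\<exists>w. length w = n \<and> is_period T w"
  then obtain w where w: "length w = n" "is_period T w"
    by blast
  then obtain u where ne: "w \<noteq> []"
    and T: "\<forall>i. T i = (if i < length u then u ! i else w ! ((i - length u) mod length w))"
    unfolding is_period_def by blast
  have "T (i + n) = T i" if "i \<ge> length u" for i
  proof -
    have "(i + n - length u) mod length w = (i - length u) mod length w"
      using that w(1) by (metis Nat.diff_add_assoc2 mod_add_self2)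
    then show ?thesis
      using that T by (metis leD trans_le_add1)
  qed
  with w ne show "n > 0 \<and> (\<exists>N. \<forall>i\<ge>N. T (i + n) = T i)"
    by auto
next
  assume "n > 0 \<and> (\<exists>N. \<forall>i\<ge>N. T (i + n) = T i)"
  then obtain N where n: "n > 0" and N: "\<And>i. i \<ge> N \<Longrightarrow> T (i + n) = T i"
    by auto
  have mult: "T (N + r + k * n) = T (N + r)" for r k
  proof (induction k)
    case (Suc k)
    then show ?case
      using N[of "N + r + k * n"] by (simp add: algebra_simps)
  qed simp
  define u w where "u = map T [0..<N]" and "w = map T [N..<N + n]"
  have "T i = (if i < length u then u ! i else w ! ((i - length u) mod length w))" for i
  proof (cases "i < N")
    case False
    then have "i = N + (i - N) mod n + (i - N) div n * n"
      by (simp only: add.assoc mod_div_mult_eq)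
    then have "T i = T (N + (i - N) mod n)"
      using mult[of "(i - N) mod n" "(i - N) div n"] by simp
    with False n show ?thesis
      by (simp add: u_def w_def)
  qed (simp add: u_def)
  moreover have "w \<noteq> []" "length w = n"
    using n by (auto simp: w_def)
  ultimately show "\<exists>w. length w = n \<and> is_period T w"
    unfolding is_period_def by blast
qed

section \<open>The recursion as a vanishing sum\<close>

lemma bit_eq_iff_add_eq_0: "(x::bit) = y \<longleftrightarrow> x + y = 0"
  by (cases x; cases y) auto

lemma sum_set_collection:
  assumes "position_collection C"
  shows "(\<Sum>x\<in>set C. f x) = (\<Sum>l<length C. f (C ! l))"
proof -
  have "distinct C"
    using assms strict_sorted_iff unfolding position_collection_def by blast
  then show ?thesis
    using sum.reindex_bij_betw[OF bij_betw_nth[OF _ refl refl], of C f] by simp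
qed

lemma position_collection_nth:
  assumes "position_collection C" and "l < length C"
  shows "hd C \<le> C ! l" and "C ! l \<le> last C"
proof -
  have "sorted C" and "C \<noteq> []"
    using assms(1) strict_sorted_iff unfolding position_collection_def by blast+
  with assms(2) show "hd C \<le> C ! l" "C ! l \<le> last C"
    by (auto simp: hd_conv_nth last_conv_nth intro!: sorted_nth_mono)
qed

text \<open>In characteristic 2 the recursion says that all \<open>r\<close> shifted values sum to zero.\<close>

lemma is_solution_iff:
  assumes "position_collection C"
  shows "is_solution C T \<longleftrightarrow> (\<forall>i \<ge> last C. (\<Sum>x\<in>set C. T (i - x)) = 0)"
proof -
  have ne: "C \<noteq> []" and hd: "hd C = C ! 0"
    using assms by (auto simp: position_collection_def hd_conv_nth)
  have le: "hd C \<le> last C"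
    using position_collection_nth[OF assms, of 0] ne by auto
  \<comment> \<open>Evaluating at \<open>i + hd C\<close> turns the position \<open>C ! l\<close>
    into the offset \<open>C ! l - C ! 0\<close>; the index \<open>l = 0\<close> contributes
    \<open>T i\<close>.\<close>
  have split: "(\<Sum>x\<in>set C. T (i + hd C - x)) = T i + (\<Sum>l = 1..<length C. T (i - (C ! l - C ! 0)))"
    for i
  proof -
    have "(\<Sum>x\<in>set C. T (i + hd C - x)) = (\<Sum>l<length C. T (i - (C ! l - C ! 0)))"
      unfolding sum_set_collection[OF assms]
    proof (intro sum.cong refl)
      fix l assume "l \<in> {..<length C}"
      then have "hd C \<le> C ! l"
        using position_collection_nth[OF assms] by simp
      then have "i + hd C - C ! l = i - (C ! l - hd C)"
        by linarith
      then show "T (i + hd C - C ! l) = T (i - (C ! l - C ! 0))"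
        by (simp only: hd)
    qed
    also have "\<dots> = T i + (\<Sum>l = 1..<length C. T (i - (C ! l - C ! 0)))"
      using ne by (simp add: lessThan_atLeast0 sum.atLeast_Suc_lessThan)
    finally show ?thesis .
  qed
  have "is_solution C T \<longleftrightarrow> (\<forall>i \<ge> last C - hd C. (\<Sum>x\<in>set C. T (i + hd C - x)) = 0)"
    unfolding is_solution_def split by (simp only: bit_eq_iff_add_eq_0[of "T i" for i])
  also have "\<dots> \<longleftrightarrow> (\<forall>i \<ge> last C. (\<Sum>x\<in>set C. T (i - x)) = 0)"
  proof (intro iffI allI impI)
    fix i assume *: "\<forall>i \<ge> last C - hd C. (\<Sum>x\<in>set C. T (i + hd C - x)) = 0" and "last C \<le> i"
    have "last C - hd C \<le> i - hd C" and "i - hd C + hd C = i"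
      using le \<open>last C \<le> i\<close> by linarith+
    with * show "(\<Sum>x\<in>set C. T (i - x)) = 0"
      by metis
  next
    fix i assume *: "\<forall>i \<ge> last C. (\<Sum>x\<in>set C. T (i - x)) = 0" and "last C - hd C \<le> i"
    then have "last C \<le> i + hd C"
      by linarith
    with * show "(\<Sum>x\<in>set C. T (i + hd C - x)) = 0"
      by blast
  qed
  finally show ?thesis .
qed

text \<open>The recursion runs backwards: in the relation at \<open>N + last C\<close> the position
  \<open>last C\<close> contributes \<open>T N\<close>, and all other terms lie beyond
  \<open>N\<close>, where \<open>T\<close> already vanishes.\<close>

lemma solution_eq_0_if_eventually_0:
  assumes C: "position_collection C" and T: "is_solution C T" and "\<And>i. i \<ge> N \<Longrightarrow> T i = 0"
  shows "T i = 0"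
  using assms(3)
proof (induction N arbitrary: i)
  case (Suc N)
  have ne: "C \<noteq> []"
    using C by (simp add: position_collection_def)
  have "0 = (\<Sum>x\<in>set C. T (N + last C - x))"
    using T unfolding is_solution_iff[OF C] by simp
  also have "\<dots> = T N + (\<Sum>x\<in>set C - {last C}. T (N + last C - x))"
    using ne by (subst sum.remove[of _ "last C"]) auto
  also have "(\<Sum>x\<in>set C - {last C}. T (N + last C - x)) = 0"
  proof (intro sum.neutral ballI)
    fix x assume x: "x \<in> set C - {last C}"
    then have "x \<le> last C"
      using position_collection_nth[OF C] by (metis DiffD1 in_set_conv_nth)
    with x have "x < last C"
      by simp
    then show "T (N + last C - x) = 0"
      by (intro Suc.prems) simp
  qed
  finally have "T N = 0"
    by simp
  then show ?case
    using Suc.IH Suc.prems by (metis le_antisym not_less_eq_eq)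
qed simp

section \<open>Two-sided periodic solutions and the spectrum\<close>

text \<open>Indices are integers so that no shift truncates and arguments can be multiplied by
  arbitrary integers. \<open>n\<close> need not be the least period.\<close>

definition periodic_solution :: "nat list \<Rightarrow> nat \<Rightarrow> (int \<Rightarrow> bit) \<Rightarrow> bool" where
  "periodic_solution C n T \<longleftrightarrow>
     (\<forall>i. T (i + int n) = T i) \<and> (\<forall>i. (\<Sum>x\<in>set C. T (i - int x)) = 0)"

text \<open>The periodic tail of a solution extends to all integers, and the extension is non-zero
  because a solution with zero tail is zero. Conversely, a two-sided solution is restricted to the
  naturals.\<close>

lemma spectrum_iff:
  assumes C: "position_collection C"
  shows "n \<in> spectrum C \<longleftrightarrow> n > 0 \<and> (\<exists>T. periodic_solution C n T \<and> (\<exists>j. T j \<noteq> 0))"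
    (is "_ \<longleftrightarrow> ?R")
proof
  have le_last: "x \<le> last C" if "x \<in> set C" for x
    using that position_collection_nth[OF C] by (metis in_set_conv_nth)
  {
    assume "n \<in> spectrum C"
    then obtain T where T: "is_solution C T" "T \<noteq> (\<lambda>_. 0)"
      and "\<exists>w. length w = n \<and> is_period T w"
      unfolding spectrum_def by auto
    then obtain N where n: "n > 0" and N: "\<And>i. i \<ge> N \<Longrightarrow> T (i + n) = T i"
      unfolding is_period_iff by auto
    have mult: "T (i + k * n) = T i" if "i \<ge> N" for i k
    proof (induction k)
      case (Suc k)
      then show ?case
        using that N[of "i + k * n"] by (simp add: algebra_simps)
    qed simp
    \<comment> \<open>The block of \<open>T\<close> on \<open>N, ..., N + n - 1\<close>, repeated in
      both directions; it agrees with \<open>T\<close> from \<open>N\<close> on.\<close>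
    define T' where "T' j = T (N + nat ((j - int N) mod int n))" for j
    have T'_eq: "T' j = T i" if "i \<ge> N" "int i mod int n = j mod int n" for i j
    proof -
      have "(j - int N) mod int n = (int i - int N) mod int n"
        using that(2) by (metis mod_diff_left_eq)
      also have "\<dots> = int ((i - N) mod n)"
        using that(1) by (simp add: of_nat_diff of_nat_mod)
      finally have "T' j = T (N + (i - N) mod n)"
        by (simp add: T'_def)
      also have "\<dots> = T (N + (i - N) mod n + (i - N) div n * n)"
        by (rule mult[symmetric]) simp
      also have "N + (i - N) mod n + (i - N) div n * n = i"
        using that(1) by (simp add: add.assoc)
      finally show ?thesis .
    qed
    have "(\<Sum>x\<in>set C. T' (j - int x)) = 0" for j
    proof -
      \<comment> \<open>A representative of \<open>j\<close> modulo \<open>n\<close> so large that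
        every \<open>i - x\<close> still lies in the periodic tail.\<close>
      define i where "i = N + last C + nat ((j - int (N + last C)) mod int n)"
      have i: "int i mod int n = j mod int n"
        using n by (simp add: i_def mod_add_right_eq)
      have "(\<Sum>x\<in>set C. T' (j - int x)) = (\<Sum>x\<in>set C. T (i - x))"
      proof (intro sum.cong refl T'_eq)
        fix x assume "x \<in> set C"
        then have "x \<le> last C"
          by (rule le_last)
        then show "N \<le> i - x" and "int (i - x) mod int n = (j - int x) mod int n"
          using i by (auto simp: i_def of_nat_diff intro: mod_diff_cong)
      qed
      also have "\<dots> = 0"
        using T(1) unfolding is_solution_iff[OF C] by (simp add: i_def)
      finally show ?thesis .
    qed
    moreover have "T' (j + int n) = T' j" for j
      by (simp add: T'_def diff_add_eq[symmetric])
    moreover have "\<exists>j. T' j \<noteq> 0"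
    proof (rule ccontr)
      assume "\<nexists>j. T' j \<noteq> 0"
      then have "T i = 0" if "i \<ge> N" for i
        using T'_eq[OF that refl] by simp
      then show False
        using solution_eq_0_if_eventually_0[OF C T(1)] T(2) by blast
    qed
    ultimately show ?R
      using n unfolding periodic_solution_def by blast
  }
  {
    assume ?R
    then obtain T j where n: "n > 0" and T: "periodic_solution C n T" and j: "T j \<noteq> 0"
      by blast
    from T have per: "\<And>i. T (i + int n) = T i"
      and sum: "\<And>i. (\<Sum>x\<in>set C. T (i - int x)) = 0"
      by (simp_all add: periodic_solution_def)
    have "is_solution C (\<lambda>i. T (int i))"
      unfolding is_solution_iff[OF C]
    proof (intro allI impI)
      fix i assume "last C \<le> i"
      then have "(\<Sum>x\<in>set C. T (int (i - x))) = (\<Sum>x\<in>set C. T (int i - int x))"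
        using le_last by (intro sum.cong refl) (metis le_trans of_nat_diff)
      then show "(\<Sum>x\<in>set C. T (int (i - x))) = 0"
        using sum by simp
    qed
    \<comment> \<open>\<open>j\<close> may be negative; its residue is a natural index with the same
      value.\<close>
    moreover have "T (int (nat (j mod int n))) = T j"
      using n by (intro periodic_mod_eq[where T = T, OF per]) simp
    with j have "(\<lambda>i. T (int i)) \<noteq> (\<lambda>_. 0)"
      by metis
    moreover have "\<exists>w. length w = n \<and> is_period (\<lambda>i. T (int i)) w"
      unfolding is_period_iff using n per by simp
    ultimately show "n \<in> spectrum C"
      unfolding spectrum_def by blast
  }
qed

section \<open>Transfer of periods between \<open>C\<close> and its multiple\<close>

lemma position_collection_scale:
  assumes "position_collection C" and "(a::nat) > 0"
  shows "position_collection (map (\<lambda>x. a * x) C)"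
  using assms by (auto simp: position_collection_def sorted_wrt_map)

lemma periodic_solution_scale:
  assumes "a > 0"
  shows "periodic_solution (map (\<lambda>x. a * x) C) n T \<longleftrightarrow>
    (\<forall>i. T (i + int n) = T i) \<and> (\<forall>i. (\<Sum>x\<in>set C. T (i - int a * int x)) = 0)"
proof -
  have "inj_on ((*) a) (set C)"
    using assms by (simp add: inj_on_def)
  then show ?thesis
    by (simp add: periodic_solution_def sum.reindex)
qed

lemma mult_eta_in_spectrum_scale:
  assumes C: "position_collection C" and a: "a > 0" and b: "b \<in> spectrum C"
  shows "b * eta a b \<in> spectrum (map (\<lambda>x. a * x) C)"
proof -
  define e c where "e = int (eta a b)" and "c = int (a div eta a b)"
  have e: "e > 0" and a_eq: "int a = e * c"
    using eta_pos[OF a] eta_dvd[OF a] by (simp_all add: e_def c_def flip: of_nat_mult)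
  from b obtain T j where "b > 0" and T: "periodic_solution C b T" and j: "T j \<noteq> 0"
    unfolding spectrum_iff[OF C] by blast
  from T have per: "\<And>i. T (i + int b) = T i"
    and sum: "\<And>i. (\<Sum>x\<in>set C. T (i - int x)) = 0"
    by (simp_all add: periodic_solution_def)
  have "coprime c (int b)"
    using coprime_div_eta[OF a, of b] by (simp add: c_def)
  then obtain c' where c': "[c * c' = 1] (mod int b)"
    using coprime_iff_invertible_int by auto
  \<comment> \<open>Since \<open>c'\<close> inverts \<open>c\<close> modulo the period, a step of
    \<open>c\<close> in the new index is a step of 1 in \<open>T\<close>: reindexing by
    \<open>c'\<close> multiplies the positions by \<open>c\<close>.\<close>
  have T_inv: "T (c' * (k - c * y)) = T (c' * k - y)" for k y
  proof (rule periodic_mod_eq[where T = T, OF per])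
    have "[c' * k - c * c' * y = c' * k - 1 * y] (mod int b)"
      using c' by (intro cong_diff cong_mult cong_refl)
    then show "c' * (k - c * y) mod int b = (c' * k - y) mod int b"
      by (simp add: cong_def algebra_simps)
  qed
  \<comment> \<open>Spreading the reindexed sequence over the multiples of \<open>e\<close>
    multiplies positions and period by \<open>e\<close>.\<close>
  define T' where "T' i = (if e dvd i then T (c' * (i div e)) else 0)" for i
  have "T' (i + int (b * eta a b)) = T' i" for i
    using e periodic_add_mult[where T = T, OF per, of "c' * (i div e)" c']
    by (simp add: T'_def distrib_left flip: e_def)
  moreover have "(\<Sum>x\<in>set C. T' (i - int a * int x)) = 0" for i
  proof (cases "e dvd i")
    case True
    then obtain k where k: "i = e * k"
      by blast
    have "i - int a * int x = e * (k - c * int x)" for x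
      by (simp add: a_eq k algebra_simps)
    then have "T' (i - int a * int x) = T (c' * k - int x)" for x
      using e T_inv by (simp add: T'_def)
    then show ?thesis
      using sum by simp
  next
    case False
    \<comment> \<open>As \<open>e\<close> divides \<open>a\<close>, all terms of the sum share the
      residue of \<open>i\<close> modulo \<open>e\<close>, so all are inserted zeros.\<close>
    then have "\<not> e dvd i - int a * int x" for x
      by (simp add: a_eq mult.assoc dvd_diff_left_iff)
    then show ?thesis
      by (simp add: T'_def)
  qed
  moreover have "T' (e * (c * j)) \<noteq> 0"
    using e T_inv[of 0 "- j"] j by (simp add: T'_def)
  ultimately show ?thesis
    unfolding spectrum_iff[OF position_collection_scale[OF C a]] periodic_solution_scale[OF a]
    using \<open>b > 0\<close> eta_pos[OF a, of b] by auto
qed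

text \<open>Sampling with step \<open>a\<close> turns the positions \<open>a * x\<close> into
  \<open>x\<close>, and \<open>n div gcd n a\<close> samples advance the index by a multiple of
  \<open>n\<close>.\<close>

lemma div_gcd_in_spectrum:
  assumes C: "position_collection C" and a: "a > 0"
    and n: "n \<in> spectrum (map (\<lambda>x. a * x) C)"
  shows "n div gcd n a \<in> spectrum C"
proof -
  from n obtain T j where "n > 0" and j: "T j \<noteq> 0"
    and T: "periodic_solution (map (\<lambda>x. a * x) C) n T"
    unfolding spectrum_iff[OF position_collection_scale[OF C a]] by blast
  from T have per: "\<And>i. T (i + int n) = T i"
    and sum: "\<And>i. (\<Sum>x\<in>set C. T (i - int a * int x)) = 0"
    by (simp_all add: periodic_solution_scale[OF a])
  \<comment> \<open>The offset \<open>j\<close> selects a residue class modulo \<open>a\<close> on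
    which \<open>T\<close> is non-zero.\<close>
  define T' where "T' i = T (int a * i + j)" for i
  have "a * (n div gcd n a) = (a div gcd n a) * n"
    by (metis div_mult_swap dvd_div_mult gcd_dvd1 gcd_dvd2 mult.commute)
  then have eq: "int a * int (n div gcd n a) = int (a div gcd n a) * int n"
    by (metis of_nat_mult)
  have "T' (i + int (n div gcd n a)) = T' i" for i
    using periodic_add_mult[where T = T, OF per, of "int a * i + j" "int (a div gcd n a)"] eq
    by (simp add: T'_def distrib_left add.assoc add.left_commute add.commute)
  moreover have "(\<Sum>x\<in>set C. T' (i - int x)) = 0" for i
    using sum[of "int a * i + j"] by (simp add: T'_def algebra_simps)
  moreover have "T' 0 \<noteq> 0"
    using j by (simp add: T'_def)
  moreover have "n div gcd n a > 0"
    using \<open>n > 0\<close> by (simp add: div_greater_zero_iff gcd_le1_nat)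
  ultimately show ?thesis
    unfolding spectrum_iff[OF C] periodic_solution_def by blast
qed

section \<open>Minimal elements under divisibility\<close>

text \<open>The numerically least divisor of \<open>b\<close> in the spectrum is minimal under
  divisibility, since periods are positive.\<close>

lemma spectrum_kernel_dvd:
  assumes "position_collection C" and "b \<in> spectrum C"
  obtains b0 where "b0 \<in> spectrum_kernel C" and "b0 dvd b"
proof -
  define b0 where "b0 = (LEAST x. x \<in> spectrum C \<and> x dvd b)"
  have b0: "b0 \<in> spectrum C" "b0 dvd b"
    using LeastI[of "\<lambda>x. x \<in> spectrum C \<and> x dvd b" b] assms(2) by (auto simp: b0_def)
  have "\<not> x dvd b0" if "x \<in> spectrum C" "x \<noteq> b0" for x
  proof
    assume "x dvd b0"
    then have "b0 \<le> x"
      using that(1) b0(2) unfolding b0_def by (metis (mono_tags, lifting) Least_le dvd_trans)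
    moreover have "x \<le> b0"
      using \<open>x dvd b0\<close> b0(1) spectrum_iff[OF assms(1)] by (simp add: dvd_imp_le)
    ultimately show False
      using that(2) by simp
  qed
  with b0 that show ?thesis
    unfolding spectrum_kernel_def by blast
qed

theorem theorem6:
  fixes C :: "nat list" and a :: nat
  assumes "position_collection C" and "a > 0"
  shows "spectrum_kernel (map (\<lambda>x. a * x) C) = {b * eta a b | b. b \<in> spectrum_kernel C}"
proof (intro subset_antisym subsetI)
  fix y assume y: "y \<in> spectrum_kernel (map (\<lambda>x. a * x) C)"
  define b where "b = y div gcd y a"
  have "y \<in> spectrum (map (\<lambda>x. a * x) C)"
    using y by (simp add: spectrum_kernel_def)
  then have "b \<in> spectrum C"
    unfolding b_def by (rule div_gcd_in_spectrum[OF assms])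
  then obtain b0 where b0: "b0 \<in> spectrum_kernel C" "b0 dvd b"
    using spectrum_kernel_dvd[OF assms(1)] by blast
  \<comment> \<open>This produces a member of the scaled spectrum dividing \<open>y\<close>;
    minimality of \<open>y\<close> forces equality.\<close>
  have "b0 * eta a b0 dvd b * eta a b"
    using b0(2) eta_mono_dvd[OF assms(2)] by (simp add: mult_dvd_mono)
  also have "\<dots> dvd y"
    unfolding b_def by (rule div_gcd_mult_eta_dvd[OF assms(2)])
  finally have "b0 * eta a b0 dvd y" .
  moreover have "b0 * eta a b0 \<in> spectrum (map (\<lambda>x. a * x) C)"
    using b0(1) mult_eta_in_spectrum_scale[OF assms] by (simp add: spectrum_kernel_def)
  ultimately have "y = b0 * eta a b0"
    using y unfolding spectrum_kernel_def by auto
  with b0(1) show "y \<in> {b * eta a b | b. b \<in> spectrum_kernel C}"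
    by blast
next
  fix y assume "y \<in> {b * eta a b | b. b \<in> spectrum_kernel C}"
  then obtain b where b: "b \<in> spectrum_kernel C" and y: "y = b * eta a b"
    by blast
  \<comment> \<open>Reducing \<open>x\<close> to a period \<open>b1\<close> of \<open>C\<close>
    gives \<open>b1 dvd b\<close> by cancellation; minimality of \<open>b\<close> yields
    \<open>b1 = b\<close>, and then \<open>y\<close> divides \<open>x\<close>.\<close>
  have "x = y" if x: "x \<in> spectrum (map (\<lambda>x. a * x) C)" "x dvd y" for x
  proof -
    define b1 where "b1 = x div gcd x a"
    have b1: "b1 \<in> spectrum C" "b1 * eta a b1 dvd x"
      unfolding b1_def using div_gcd_in_spectrum[OF assms x(1)] div_gcd_mult_eta_dvd[OF assms(2)]
      by auto
    then have "b1 dvd b"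
      using x(2) mult_eta_dvd_cancel[OF assms(2)] unfolding y by (meson dvd_trans)
    then have "b1 = b"
      using b b1(1) unfolding spectrum_kernel_def by blast
    then show ?thesis
      using b1(2) x(2) unfolding y by (simp add: dvd_antisym)
  qed
  moreover have "y \<in> spectrum (map (\<lambda>x. a * x) C)"
    using b mult_eta_in_spectrum_scale[OF assms] by (simp add: y spectrum_kernel_def)
  ultimately show "y \<in> spectrum_kernel (map (\<lambda>x. a * x) C)"
    unfolding spectrum_kernel_def by blast
qed

end
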